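(* Let $r=[m_1,m_2,\dots,m_k]$ be a rational number with $0<r<1$, and let $$\tilde r=\begin{cases}[m_1-1,m_2,m_3,\dots,m_k] & \text{if } m_1\ge2,\\ [m_2+1,m_3,m_4,\dots,m_k] & \text{if } m_1=1.\end{cases}$$ Put $CS(\tilde r)=(\!(a_1,a_2,\dots,a_t,a_1,a_2,\dots,a_t)\!)$. Then the following hold. (1) If $m_1\ge2$, then $$CS(r)=(\!(a_1+1,a_2+1,\dots,a_t+1,a_1+1,a_2+1,\dots,a_t+1)\!).$$ (2) If $m_1=1$, then every $a_i$ is at least $2$, and either $$CS(r)=(\!(2,b_1\langle1\rangle,2,b_2\langle1\rangle,\dots,2,b_t\langle1\rangle,2,b_1\langle1\rangle,2,b_2\langle1\rangle,\dots,2,b_t\langle1\rangle)\!)$$ or $$CS(r)=(\!(2,b_t\langle1\rangle,\dots,2,b_2\langle1\rangle,2,b_1\langle1\rangle,2,b_t\langle1\rangle,\dots,2,b_2\langle1\rangle,2,b_1\langle1\rangle)\!),$$ where $b_i=a_i-2$ for every $i$, and $b_i\langle1\rangle$ represents $b_i$ successive $1$'s (the empty subsequence if $b_i=0$).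
   Context: **Continued fractions.** $[m_1,\dots,m_k]=\cfrac{1}{m_1+\cfrac{1}{m_2+\cdots+\cfrac{1}{m_k}}}$. Every rational $r$ with $0<r\le1$ is written $r=[m_1,\dots,m_k]$ with $k\ge1$, $m_i$ positive integers, and $m_k\ge2$ unless $k=1$. **The word $u_r$.** For a positive rational number $r=q/p$ with $p,q$ relatively prime positive integers, set $\epsilon_i=(-1)^{\lfloor iq/p\rfloor}$ and define a word in the free generators $a,b$ by: - if $p$ is odd, $u_{q/p}=a\,\hat u_{q/p}\,b^{(-1)^q}\,\hat u_{q/p}^{-1}$ with $\hat u_{q/p}=b^{\epsilon_1}a^{\epsilon_2}\cdots b^{\epsilon_{p-2}}a^{\epsilon_{p-1}}$ (empty if $p=1$); - if $p$ is even, $u_{q/p}=a\,\hat u_{q/p}\,a^{-1}\,\hat u_{q/p}^{-1}$ with $\hat u_{q/p}=b^{\epsilon_1}a^{\epsilon_2}\cdots a^{\epsilon_{p-2}}b^{\epsilon_{p-1}}$. **Cyclic $S$-sequence.** For a cyclically reduced word $v$ in $\{a,b\}$, let $(v)$ be the cyclic word consisting of all its cyclic permutations. Decompose $(v)\equiv(v_1v_2\cdots v_t)$ into maximal blocks such that all letters in each $v_i$ have exponents of one sign and all letters in $v_{i+1}$ have exponents of the opposite sign (indices mod $t$). Then $CS(v):=(\!(|v_1|,|v_2|,\dots,|v_t|)\!)$, where $|\cdot|$ is word length and double parentheses mean the sequence is considered modulo cyclic permutations. For rational $0<r\le1$, put $CS(r):=CS(u_r)$. For $r=q/p$ in lowest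 terms, it is known that $CS(r)$ has length $2q$ and is invariant under the half-rotation (it consists of a sequence of length $q$ repeated twice); this is why $CS(\tilde r)$ can be written in the form used in the claim. *)

theory Defs
  imports Complex_Main
begin

subsection \<open>Continued fractions\<close>

fun cfrac :: "nat list \<Rightarrow> rat" where
  "cfrac [] = 0"
| "cfrac (m # ms) = 1 / (of_nat m + cfrac ms)"

definition cfrac_expansion :: "nat list \<Rightarrow> rat \<Rightarrow> bool" where
  "cfrac_expansion ms r \<longleftrightarrow>
     ms \<noteq> [] \<and> (\<forall>m\<in>set ms. m \<ge> 1) \<and> (length ms \<noteq> 1 \<longrightarrow> last ms \<ge> 2) \<and> r = cfrac ms"

text \<open>The passage from \<open>r\<close> to \<open>r\<close>-tilde. The branch with first entry 1 is only meaningful when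
  there is a second entry, which is guaranteed for expansions of rationals less than 1.\<close>

fun tilde :: "nat list \<Rightarrow> nat list" where
  "tilde [] = []"
| "tilde (m # ms) = (if m \<ge> 2 then (m - 1) # ms else (hd ms + 1) # tl ms)"

subsection \<open>The word \<open>u\<^sub>r\<close>\<close>

datatype gen = Gen_a | Gen_b

text \<open>A letter is a generator together with its exponent, which is always 1 or -1 below. In
  particular the length of the list of letters is the word length.\<close>

type_synonym letter = "gen \<times> int"

definition word_inv :: "letter list \<Rightarrow> letter list" where
  "word_inv w = rev (map (\<lambda>(g, e). (g, - e)) w)"

definition eps :: "nat \<Rightarrow> nat \<Rightarrow> nat \<Rightarrow> int" where
  "eps q p i = (- 1) ^ nat \<lfloor>of_nat (i * q) / (of_nat p :: rat)\<rfloor>"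

text \<open>The generators alternate and the first one is \<open>b\<close>; the last one (position \<open>p - 1\<close>) is thus
  \<open>a\<close> for odd \<open>p\<close> and \<open>b\<close> for even \<open>p\<close>, so one formula covers both parities.\<close>

definition u_hat :: "nat \<Rightarrow> nat \<Rightarrow> letter list" where
  "u_hat q p = map (\<lambda>i. (if odd i then Gen_b else Gen_a, eps q p i)) [1..<p]"

definition u_frac :: "nat \<Rightarrow> nat \<Rightarrow> letter list" where
  "u_frac q p =
     (if odd p
      then [(Gen_a, 1)] @ u_hat q p @ [(Gen_b, (- 1) ^ q)] @ word_inv (u_hat q p)
      else [(Gen_a, 1)] @ u_hat q p @ [(Gen_a, - 1)] @ word_inv (u_hat q p))"

definition u_word :: "rat \<Rightarrow> letter list" where
  "u_word r = (case quotient_of r of (q, p) \<Rightarrow> u_frac (nat q) (nat p))"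

subsection \<open>Cyclic \<open>S\<close>-sequences\<close>

text \<open>A sequence modulo cyclic permutations is represented by the set of all its rotations.\<close>

definition cyc :: "'a list \<Rightarrow> 'a list set" where
  "cyc xs = {rotate n xs | n. True}"

text \<open>Decompositions of the cyclic word of \<open>v\<close> into blocks of constant sign, cyclically
  neighbouring blocks having opposite signs (so the blocks are maximal).\<close>

definition sign_blocks :: "letter list \<Rightarrow> letter list list \<Rightarrow> bool" where
  "sign_blocks v vs \<longleftrightarrow>
     concat vs \<in> cyc v \<and>
     (\<forall>w\<in>set vs. w \<noteq> [] \<and> (\<forall>x\<in>set w. \<forall>y\<in>set w. sgn (snd x) = sgn (snd y))) \<and>
     (\<forall>i<length vs. \<forall>x\<in>set (vs ! i). \<forall>y\<in>set (vs ! (Suc i mod length vs)).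
        sgn (snd y) = - sgn (snd x))"

text \<open>Different decompositions differ by a cyclic permutation of the blocks, so for a word in which
  both signs occur the following set is a single class \<open>cyc s\<close>. (A nonempty word with only one
  sign has no decomposition.)\<close>

definition CS_word :: "letter list \<Rightarrow> nat list set" where
  "CS_word v = {map length vs | vs. sign_blocks v vs}"

definition CS :: "rat \<Rightarrow> nat list set" where
  "CS r = CS_word (u_word r)"

end

theory Submission
  imports Defs
begin

text \<open>The inverted second half of the word \<open>u\<^sub>r\<close> continues the sign pattern of its first half: for
  \<open>r = q / p\<close> in lowest terms, the letter number \<open>i\<close> of \<open>u\<^sub>r\<close>, counted from \<open>0\<close> to \<open>2 p - 1\<close>, has sign
  \<open>(-1) ^ \<lfloor>i q / p\<rfloor>\<close> (\<open>u_frac_sign\<close>). The floor grows by at most 1 in each step, so the blocks are its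
  level sets. Since \<open>\<lfloor>i q / p\<rfloor> \<ge> j\<close> means \<open>i \<ge> \<lceil>j p / q\<rceil>\<close>, the cyclic sequence of \<open>r\<close> consists of the
  \<open>2 q\<close> differences of \<open>j \<mapsto> \<lceil>j p / q\<rceil>\<close> (\<open>CS_frac\<close>). This needs that a cyclic word has only one
  decomposition into sign blocks up to rotation (\<open>sign_blocks_unique\<close>).

  The rest is arithmetic of floors and ceilings. If \<open>m\<^sub>1 \<ge> 2\<close>, the passage to \<open>r\<close>-tilde replaces \<open>q / p\<close>
  by \<open>q / (p - q)\<close>, which lowers each \<open>\<lceil>j p / q\<rceil>\<close> by \<open>j\<close> and hence each difference by 1
  (\<open>steps_ceil_shift\<close>).

  If \<open>m\<^sub>1 = 1\<close>, it replaces \<open>r\<close> by \<open>1 - r = s / p\<close> with \<open>s = p - q\<close>. Now \<open>1 < p / q \<le> 2\<close>, so all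
  differences for \<open>r\<close> are 1 or 2, and the places of the 2s are spaced according to the differences of
  \<open>l \<mapsto> \<lfloor>l p / s\<rfloor>\<close> (\<open>steps_ceil_segments\<close>). The sequence of \<open>1 - r\<close> lists the differences of
  \<open>l \<mapsto> \<lceil>l p / s\<rceil>\<close> instead, which are the same numbers in reverse order, because
  \<open>\<lfloor>(2 s - l) p / s\<rfloor> = 2 p - \<lceil>l p / s\<rceil>\<close> (\<open>steps_ceil_floor\<close>). So the second of the two alternatives
  in the claim, with the order of the \<open>a\<^sub>i\<close> reversed, always holds. The given list of the \<open>a\<^sub>i\<close>, doubled,
  is only known up to rotation, but rotations are compatible with all the operations involved.\<close>

section \<open>Cyclic sequences\<close>

lemma self_in_cyc: "xs \<in> cyc xs"
  unfolding cyc_def by (metis (mono_tags, lifting) mem_Collect_eq rotate0 id_apply)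

lemma cyc_trans: "xs \<in> cyc ys \<Longrightarrow> ys \<in> cyc zs \<Longrightarrow> xs \<in> cyc zs"
  unfolding cyc_def by (auto simp: rotate_rotate)

lemma cyc_sym:
  assumes "xs \<in> cyc ys" shows "ys \<in> cyc xs"
proof -
  obtain n where n: "xs = rotate n ys" using assms by (auto simp: cyc_def)
  have "ys = rotate (length ys - n mod length ys) xs"
  proof (cases "ys = []")
    case False
    have "length ys - n mod length ys + n mod length ys = length ys"
      using False by (simp add: less_imp_le)
    then have "rotate (length ys - n mod length ys) (rotate (n mod length ys) ys) = ys"
      by (simp add: rotate_rotate)
    then show ?thesis using n by (metis rotate_conv_mod)
  qed (simp add: n)
  then show ?thesis unfolding cyc_def by blast
qed

lemma cyc_eq_iff: "cyc xs = cyc ys \<longleftrightarrow> xs \<in> cyc ys"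
  using self_in_cyc cyc_trans cyc_sym by blast

lemma cyc_map: "xs \<in> cyc ys \<Longrightarrow> map f xs \<in> cyc (map f ys)"
  unfolding cyc_def by (auto simp: rotate_map)

lemma cyc_append_swap: "xs @ ys \<in> cyc (ys @ xs)"
  unfolding cyc_def by (intro CollectI exI[of _ "length ys"]) (simp add: rotate_append)

lemma cyc_rev:
  assumes "xs \<in> cyc ys" shows "rev xs \<in> cyc (rev ys)"
proof -
  obtain n where "xs = drop n ys @ take n ys"
    using assms by (auto simp: cyc_def rotate_drop_take)
  then have "rev xs = rev (take n ys) @ rev (drop n ys)" by simp
  also have "\<dots> \<in> cyc (rev (drop n ys) @ rev (take n ys))" by (rule cyc_append_swap)
  finally show ?thesis by (simp flip: rev_append)
qed

lemma cyc_concat_rotate: "concat (rotate n xss) \<in> cyc (concat xss)"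
proof (induction n)
  case 0
  then show ?case by (simp add: self_in_cyc)
next
  case (Suc n)
  have "concat (rotate1 yss) \<in> cyc (concat yss)" for yss :: "'a list list"
    by (cases yss) (simp_all add: self_in_cyc cyc_append_swap)
  with Suc show ?case by (auto intro: cyc_trans)
qed

lemma cyc_concat: "xss \<in> cyc yss \<Longrightarrow> concat xss \<in> cyc (concat yss)"
  by (auto simp: cyc_def[of yss] cyc_concat_rotate)

lemma set_cyc: "xs \<in> cyc ys \<Longrightarrow> set xs = set ys"
  by (auto simp: cyc_def)


section \<open>Decompositions into sign blocks\<close>

definition monochrome :: "('a \<Rightarrow> 'b) \<Rightarrow> 'a list \<Rightarrow> bool" where
  "monochrome f w \<longleftrightarrow> w \<noteq> [] \<and> (\<forall>x\<in>set w. \<forall>y\<in>set w. f x = f y)"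

text \<open>Only block boundaries can separate neighbouring letters of different colour.\<close>

lemma colour_change_at_boundary:
  assumes "concat ws = xs @ ys" "xs \<noteq> []" "ys \<noteq> []" "f (last xs) \<noteq> f (hd ys)"
    and "\<forall>w\<in>set ws. monochrome f w"
  obtains ws1 ws2 where "ws = ws1 @ ws2" "xs = concat ws1" "ys = concat ws2"
proof -
  have "ws \<noteq> []" using assms by auto
  then obtain us w w' vs where *: "ws = us @ (w @ w') # vs" "xs = concat us @ w" "ys = w' @ concat vs"
    using assms(1) by (auto simp: concat_eq_append_conv)
  have "w = [] \<or> w' = []"
  proof (rule ccontr)
    assume "\<not> ?thesis"
    then have "last xs = last w" "hd ys = hd w'" "last w \<in> set (w @ w')" "hd w' \<in> set (w @ w')"
      using * by auto
    moreover have "monochrome f (w @ w')" using * assms(5) by simp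
    ultimately show False using assms(4) unfolding monochrome_def by metis
  qed
  then show ?thesis
  proof
    assume "w = []"
    then show ?thesis using that[of us "w' # vs"] * by simp
  next
    assume "w' = []"
    then show ?thesis using that[of "us @ [w]" vs] * by simp
  qed
qed

text \<open>The key step of uniqueness: if one decomposition starts with the block \<open>y @ us\<close> and another one
  with \<open>y\<close>, then the second block of the latter starts inside the first block of the former, so it
  cannot change the colour.\<close>

lemma overhang_impossible:
  assumes "monochrome f (y @ us)" "us \<noteq> []" "us @ zs = concat ws"
    and "\<forall>w\<in>set (y # ws). monochrome f w" "successively (\<lambda>v w. f (hd v) \<noteq> f (hd w)) (y # ws)"
  shows False
proof -
  obtain w ws' where ws: "ws = w # ws'" using assms(2,3) by (cases ws) auto
  have "w \<noteq> []" "y \<noteq> []" using assms(4) ws by (auto simp: monochrome_def)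
  have "hd w = hd us" using assms(2,3) ws \<open>w \<noteq> []\<close> by (metis concat.simps(2) hd_append2)
  moreover have "f (hd y) = f (hd us)"
    using assms(1,2) \<open>y \<noteq> []\<close> unfolding monochrome_def by auto
  ultimately show False using assms(5) ws by simp
qed

lemma run_decomposition_unique:
  assumes "concat vs = concat ws"
    and "\<forall>w\<in>set vs. monochrome f w" "\<forall>w\<in>set ws. monochrome f w"
    and "successively (\<lambda>v w. f (hd v) \<noteq> f (hd w)) vs"
    and "successively (\<lambda>v w. f (hd v) \<noteq> f (hd w)) ws"
  shows "vs = ws"
  using assms
proof (induction vs arbitrary: ws)
  case Nil
  then show ?case by (cases ws) (auto simp: monochrome_def)
next
  case (Cons x vs)
  obtain y ws' where ws: "ws = y # ws'"
    using Cons.prems(1,2) by (cases ws) (auto simp: monochrome_def)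
  from Cons.prems(1) ws have "x @ concat vs = y @ concat ws'" by simp
  then obtain us where us: "x = y @ us \<and> us @ concat vs = concat ws' \<or>
      x @ us = y \<and> concat vs = us @ concat ws'"
    by (auto simp: append_eq_append_conv2)
  have "us = []"
  proof (rule ccontr)
    assume "us \<noteq> []"
    from us show False
    proof
      assume "x = y @ us \<and> us @ concat vs = concat ws'"
      then show False
        using overhang_impossible[of f y us "concat vs" ws'] \<open>us \<noteq> []\<close> Cons.prems ws by auto
    next
      assume "x @ us = y \<and> concat vs = us @ concat ws'"
      then show False
        using overhang_impossible[of f x us "concat ws'" vs] \<open>us \<noteq> []\<close> Cons.prems ws by auto
    qed
  qed
  then have eq: "x = y" "concat vs = concat ws'" using us by auto
  have "vs = ws'"
    using Cons.prems ws eq by (intro Cons.IH) (auto simp: successively_Cons)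
  then show ?case using ws eq by simp
qed

lemma sign_blocksD:
  assumes "sign_blocks v vs"
  shows sign_blocks_concat: "concat vs \<in> cyc v"
    and sign_blocks_nonempty: "w \<in> set vs \<Longrightarrow> w \<noteq> []"
    and sign_blocks_same: "w \<in> set vs \<Longrightarrow> x \<in> set w \<Longrightarrow> y \<in> set w \<Longrightarrow> sgn (snd x) = sgn (snd y)"
    and sign_blocks_alternate: "i < length vs \<Longrightarrow> x \<in> set (vs ! i) \<Longrightarrow>
      y \<in> set (vs ! (Suc i mod length vs)) \<Longrightarrow> sgn (snd y) = - sgn (snd x)"
proof -
  note D = assms[unfolded sign_blocks_def]
  show "concat vs \<in> cyc v" by (rule D[THEN conjunct1])
  show "w \<in> set vs \<Longrightarrow> w \<noteq> []" by (rule D[THEN conjunct2, THEN conjunct1, rule_format, THEN conjunct1])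
  show "w \<in> set vs \<Longrightarrow> x \<in> set w \<Longrightarrow> y \<in> set w \<Longrightarrow> sgn (snd x) = sgn (snd y)"
    by (rule D[THEN conjunct2, THEN conjunct1, rule_format, THEN conjunct2, rule_format])
  show "i < length vs \<Longrightarrow> x \<in> set (vs ! i) \<Longrightarrow>
      y \<in> set (vs ! (Suc i mod length vs)) \<Longrightarrow> sgn (snd y) = - sgn (snd x)"
    by (rule D[THEN conjunct2, THEN conjunct2, rule_format])
qed

text \<open>The conditions on neighbouring blocks are cyclic, so they do not see where the list of blocks
  begins.\<close>

lemma sign_blocks_rotate:
  assumes "sign_blocks v vs" shows "sign_blocks v (rotate n vs)"
proof -
  have "\<forall>x\<in>set (rotate n vs ! i). \<forall>y\<in>set (rotate n vs ! (Suc i mod length vs)).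
        sgn (snd y) = - sgn (snd x)" if i: "i < length vs" for i
  proof -
    have "rotate n vs ! i = vs ! ((n + i) mod length vs)"
      using i by (simp add: nth_rotate)
    moreover have "rotate n vs ! (Suc i mod length vs) = vs ! (Suc ((n + i) mod length vs) mod length vs)"
      using i by (subst nth_rotate) (auto simp: mod_simps intro!: mod_less_divisor)
    moreover have "(n + i) mod length vs < length vs" using i by (intro mod_less_divisor) auto
    ultimately show ?thesis using sign_blocks_alternate[OF assms] by metis
  qed
  moreover have "concat (rotate n vs) \<in> cyc v"
    using sign_blocks_concat[OF assms] by (rule cyc_trans[OF cyc_concat_rotate])
  ultimately show ?thesis
    using assms unfolding sign_blocks_def set_rotate length_rotate by blast
qed

context
  fixes v :: "letter list" and vs
  assumes nonzero: "\<forall>x\<in>set v. snd x \<noteq> 0" and blocks: "sign_blocks v vs"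
begin

lemma sign_blocks_monochrome: "\<forall>w\<in>set vs. monochrome (\<lambda>x. sgn (snd x)) w"
  unfolding monochrome_def
  using sign_blocks_nonempty[OF blocks] sign_blocks_same[OF blocks] by blast

lemma sign_blocks_opposite:
  assumes "i < length vs" "x \<in> set (vs ! i)" "y \<in> set (vs ! (Suc i mod length vs))"
  shows "sgn (snd x) \<noteq> sgn (snd y)"
proof -
  have "x \<in> set (concat vs)" using assms by (auto intro: nth_mem)
  then have "snd x \<noteq> 0" using nonzero set_cyc[OF sign_blocks_concat[OF blocks]] by blast
  moreover have "sgn (snd y) = - sgn (snd x)" using assms by (rule sign_blocks_alternate[OF blocks])
  ultimately show ?thesis by (simp add: sgn_if split: if_splits)
qed

lemma sign_blocks_successively:
  "successively (\<lambda>v w. sgn (snd (hd v)) \<noteq> sgn (snd (hd w))) vs"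
proof -
  have "sgn (snd (hd (vs ! i))) \<noteq> sgn (snd (hd (vs ! Suc i)))" if "Suc i < length vs" for i
  proof (rule sign_blocks_opposite)
    show "hd (vs ! i) \<in> set (vs ! i)" "hd (vs ! Suc i) \<in> set (vs ! (Suc i mod length vs))"
      using that sign_blocks_monochrome by (auto simp: monochrome_def)
  qed (use that in simp)
  then show ?thesis by (simp add: successively_conv_nth)
qed

lemma sign_blocks_ends:
  assumes "v \<noteq> []"
  shows "sgn (snd (last (concat vs))) \<noteq> sgn (snd (hd (concat vs)))"
proof -
  have "vs \<noteq> []" using assms set_cyc[OF sign_blocks_concat[OF blocks]] by auto
  then have "hd vs \<noteq> []" "last vs \<noteq> []" using sign_blocks_monochrome by (auto simp: monochrome_def)
  have "last (concat vs) = last (last vs)"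
    using \<open>vs \<noteq> []\<close> \<open>last vs \<noteq> []\<close> by (cases vs rule: rev_cases) auto
  moreover have "hd (concat vs) = hd (hd vs)"
    using \<open>vs \<noteq> []\<close> \<open>hd vs \<noteq> []\<close> by (cases vs) auto
  moreover have "sgn (snd (last (last vs))) \<noteq> sgn (snd (hd (hd vs)))"
    using \<open>vs \<noteq> []\<close> \<open>hd vs \<noteq> []\<close> \<open>last vs \<noteq> []\<close>
    by (intro sign_blocks_opposite[of "length vs - 1"]) (auto simp: last_conv_nth hd_conv_nth)
  ultimately show ?thesis by simp
qed

end

text \<open>The first letter of any decomposition differs in sign from its cyclic predecessor. Hence the
  place where a second decomposition of the same cyclic word begins is a block boundary of the
  first one, and after a rotation of the blocks both decompose the same linear word.\<close>

lemma sign_blocks_unique: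
  assumes nz: "\<forall>x\<in>set v. snd x \<noteq> 0" and "v \<noteq> []"
    and vs: "sign_blocks v vs" and ws: "sign_blocks v ws"
  shows "vs \<in> cyc ws"
proof -
  note mono = sign_blocks_monochrome[OF nz]
  have "concat vs \<in> cyc (concat ws)"
    using cyc_trans[OF sign_blocks_concat[OF vs] cyc_sym[OF sign_blocks_concat[OF ws]]] .
  then obtain n where n: "concat vs = rotate n (concat ws)" by (auto simp: cyc_def)
  define xs ys where "xs = take (n mod length (concat ws)) (concat ws)"
    and "ys = drop (n mod length (concat ws)) (concat ws)"
  have V: "concat vs = ys @ xs" and W: "concat ws = xs @ ys"
    using n by (auto simp: rotate_drop_take xs_def ys_def)
  obtain ws1 ws2 where "ws = ws1 @ ws2" "xs = concat ws1" "ys = concat ws2"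
  proof (cases "xs = [] \<or> ys = []")
    case True
    then show ?thesis using that[of "[]" ws] that[of ws "[]"] W by auto
  next
    case False
    with sign_blocks_ends[OF nz vs \<open>v \<noteq> []\<close>]
    have "sgn (snd (last xs)) \<noteq> sgn (snd (hd ys))" by (simp add: V)
    then show ?thesis
      using colour_change_at_boundary[OF W, of "\<lambda>x. sgn (snd x)"] False that mono[OF ws] by blast
  qed
  then have rot: "rotate (length ws1) ws = ws2 @ ws1" and "concat vs = concat (ws2 @ ws1)"
    using V by (auto simp: rotate_append)
  note ws' = sign_blocks_rotate[OF ws, of "length ws1"]
  \<comment> \<open>Both lists of blocks now have the same concatenation, not only up to rotation.\<close>
  have "vs = rotate (length ws1) ws"
    unfolding rot
    using run_decomposition_unique[OF \<open>concat vs = concat (ws2 @ ws1)\<close>, of "\<lambda>x. sgn (snd x)"]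
      mono[OF vs] mono[OF ws'] sign_blocks_successively[OF nz vs] sign_blocks_successively[OF nz ws']
    by (simp add: rot)
  then show ?thesis by (auto simp: cyc_def)
qed

lemma CS_word_eq:
  assumes "\<forall>x\<in>set v. snd x \<noteq> 0" "v \<noteq> []" "sign_blocks v vs"
  shows "CS_word v = cyc (map length vs)"
proof
  show "CS_word v \<subseteq> cyc (map length vs)"
    using sign_blocks_unique[OF assms(1,2) _ assms(3)] cyc_map by (auto simp: CS_word_def)
  show "cyc (map length vs) \<subseteq> CS_word v"
  proof
    fix s assume "s \<in> cyc (map length vs)"
    then obtain n where "s = map length (rotate n vs)" by (auto simp: cyc_def rotate_map)
    then show "s \<in> CS_word v" using sign_blocks_rotate[OF assms(3)] by (auto simp: CS_word_def)
  qed
qed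


section \<open>Block lengths as successive differences\<close>

definition steps :: "(nat \<Rightarrow> nat) \<Rightarrow> nat \<Rightarrow> nat list" where
  "steps c n = map (\<lambda>j. c (Suc j) - c j) [0..<n]"

lemma concat_upt_partition:
  assumes "mono c"
  shows "concat (map (\<lambda>j. [c j..<c (Suc j)]) [0..<n]) = [c 0..<c n]"
proof (induction n)
  case (Suc n)
  have "c 0 \<le> c n" "c n \<le> c (Suc n)" by (rule monoD[OF assms], simp)+
  then have "[c 0..<c (Suc n)] = [c 0..<c n] @ [c n..<c (Suc n)]"
    by (metis le_add_diff_inverse upt_add_eq_append)
  then show ?case using Suc by simp
qed simp

text \<open>The number \<open>t\<close> of blocks has to be even for the signs to alternate also across the end of the
  word.\<close>

lemma CS_word_boundaries:
  assumes c: "c 0 = 0" "strict_mono c" and t: "even t" "t > 0" and len: "length v = c t"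
    and sign: "\<And>i j. j < t \<Longrightarrow> c j \<le> i \<Longrightarrow> i < c (Suc j) \<Longrightarrow> sgn (snd (v ! i)) = (-1) ^ j"
  shows "CS_word v = cyc (steps c t)"
proof -
  define vs where "vs = map (\<lambda>j. map ((!) v) [c j..<c (Suc j)]) [0..<t]"
  have "concat vs = map ((!) v) (concat (map (\<lambda>j. [c j..<c (Suc j)]) [0..<t]))"
    by (simp add: vs_def map_concat comp_def)
  also have "\<dots> = map ((!) v) [0..<length v]"
    by (simp only: concat_upt_partition[OF strict_mono_mono[OF c(2)]] c len)
  also have "\<dots> = v" by (rule map_nth)
  finally have concat: "concat vs = v" .
  have lt: "c j < c (Suc j)" for j using c(2) by (simp add: strict_mono_Suc_iff)
  have block: "sgn (snd x) = (-1) ^ j" if "j < t" "x \<in> set (vs ! j)" for x j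
    using that by (auto simp: vs_def sign)
  have [simp]: "length vs = t" by (simp add: vs_def)
  have nz: "snd x \<noteq> 0" if x: "x \<in> set v" for x
  proof -
    from x obtain j where "j < t" "x \<in> set (vs ! j)"
      unfolding concat[symmetric] by (auto simp: in_set_conv_nth[of _ vs])
    then have "sgn (snd x) = (-1) ^ j" by (rule block)
    then show ?thesis by auto
  qed
  have "sign_blocks v vs"
    unfolding sign_blocks_def
  proof (intro conjI ballI allI impI)
    show "concat vs \<in> cyc v" by (simp add: concat self_in_cyc)
  next
    fix w assume "w \<in> set vs"
    then obtain j where "w = map ((!) v) [c j..<c (Suc j)]" by (auto simp: vs_def)
    then show "w \<noteq> []" using lt[of j] by simp
  next
    fix w x y assume "w \<in> set vs" "x \<in> set w" "y \<in> set w"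
    then show "sgn (snd x) = sgn (snd y)"
      using block by (metis \<open>length vs = t\<close> in_set_conv_nth)
  next
    fix i x y
    assume i: "i < length vs" and x: "x \<in> set (vs ! i)"
      and y: "y \<in> set (vs ! (Suc i mod length vs))"
    have "even (Suc i mod t) = even (Suc i)"
      using t(1) by (simp add: dvd_mod_iff)
    then have "(-1 :: int) ^ (Suc i mod t) = (-1) ^ Suc i"
      by (simp add: minus_one_power_iff)
    moreover have "sgn (snd y) = (-1) ^ (Suc i mod t)"
      using block[of "Suc i mod t" y] y t by simp
    ultimately show "sgn (snd y) = - sgn (snd x)" using block[of i x] i x by simp
  qed
  moreover have "c t > 0" using c t by (metis strict_monoD)
  then have "v \<noteq> []" using len by auto
  moreover have "map length vs = steps c t" by (simp add: vs_def steps_def comp_def)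
  ultimately show ?thesis using CS_word_eq[of v vs] nz by simp
qed

text \<open>A half turn of the graph of a function reverses the order of its differences.\<close>

lemma steps_reflect:
  assumes "\<And>j. j \<le> n \<Longrightarrow> c j \<le> N \<and> h (n - j) = N - c j"
  shows "steps c n = rev (steps h n)"
proof (rule nth_equalityI)
  fix j assume "j < length (steps c n)"
  then have j: "j < n" by (simp add: steps_def)
  have "n - j = Suc (n - Suc j)" using j by simp
  then have "h (Suc (n - Suc j)) = N - c j" "h (n - Suc j) = N - c (Suc j)"
    using assms[of j] assms[of "Suc j"] j by auto
  then show "steps c n ! j = rev (steps h n) ! j"
    using j assms[of j] assms[of "Suc j"] by (simp add: steps_def rev_nth)
qed (simp add: steps_def)


section \<open>The cyclic sequence of a fraction\<close>

definition ceil_div :: "nat \<Rightarrow> nat \<Rightarrow> nat" where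
  "ceil_div a b = (a + (b - 1)) div b"

lemma ceil_div_le_iff:
  assumes "b > 0" shows "ceil_div a b \<le> i \<longleftrightarrow> a \<le> i * b"
proof -
  have "ceil_div a b \<le> i \<longleftrightarrow> a + (b - 1) < Suc i * b"
    using assms by (simp add: ceil_div_def less_Suc_eq_le[symmetric] div_less_iff_less_mult del: mult_Suc)
  then show ?thesis using assms by auto
qed

lemma ceil_div_add_mult: "b > 0 \<Longrightarrow> ceil_div (k * b + a) b = k + ceil_div a b"
  unfolding ceil_div_def add.assoc by (rule div_mult_self3) simp

lemma ceil_div_mono: "a \<le> a' \<Longrightarrow> ceil_div a b \<le> ceil_div a' b"
  by (simp add: ceil_div_def div_le_mono)

lemma eps_eq: "eps q p i = (-1) ^ (i * q div p)"
  by (simp add: eps_def floor_divide_of_nat_eq del: of_nat_mult)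

text \<open>As \<open>\<lfloor>(p - j) q / p\<rfloor> = q - 1 - \<lfloor>j q / p\<rfloor>\<close> for \<open>0 < j < p\<close>, inverting and reversing the first half of
  the word just continues the pattern of its signs.\<close>

lemma eps_reflect:
  assumes "coprime q p" "0 < j" "j < p"
  shows "- eps q p (p - j) = eps q p (p + j)"
proof -
  have nd: "\<not> p dvd j * q"
    using assms by (metis coprime_commute coprime_dvd_mult_left_iff nat_dvd_not_less)
  define k where "k = j * q div p"
  define m where "m = j * q mod p"
  have jq: "j * q = k * p + m" "0 < m" "m < p"
    using nd assms by (auto simp: k_def m_def mod_greater_zero_iff_not_dvd)
  have "k * p < q * p" using jq assms by (metis add_lessD1 le_add1 le_less_trans mult.commute mult_less_mono1
      neq0_conv nd dvd_0_right mult_0_right)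
  then have "k < q" by simp
  have "(p - j) * q = (q - 1 - k) * p + (p - m)"
  proof -
    obtain d where d: "q = Suc (k + d)" using \<open>k < q\<close> less_iff_Suc_add by auto
    have "(p - j) * q = p * q - (k * p + m)" using jq by (simp add: diff_mult_distrib)
    also have "p * q = k * p + d * p + p" by (simp add: d algebra_simps)
    finally show ?thesis using jq d by simp
  qed
  also have "\<dots> div p = q - 1 - k + (p - m) div p"
    by (rule div_mult_self3) (use assms in simp)
  finally have "(p - j) * q div p = q - 1 - k" using jq by simp
  moreover have "(p + j) * q div p = q + k" using assms by (simp add: add_mult_distrib k_def)
  moreover have "even (q - 1 - k) \<longleftrightarrow> odd (q + k)" using \<open>k < q\<close> by auto
  ultimately show ?thesis by (auto simp: eps_eq minus_one_power_iff)
qed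

lemma length_u_frac: "0 < p \<Longrightarrow> length (u_frac q p) = 2 * p"
  by (simp add: u_frac_def u_hat_def word_inv_def)

text \<open>The letter in the middle fits into the pattern as well: its exponent is \<open>(-1) ^ q\<close> also for even
  \<open>p\<close>, as \<open>q\<close> is then odd.\<close>

lemma u_frac_sign:
  assumes "coprime q p" "0 < p" "i < 2 * p"
  shows "snd (u_frac q p ! i) = (-1) ^ (i * q div p)"
proof -
  have "snd (u_frac q p ! i) = (map snd (u_frac q p)) ! i"
    using assms length_u_frac by simp
  also have "map snd (u_frac q p) =
      1 # map (eps q p) [1..<p] @ (-1) ^ q # rev (map (\<lambda>j. - eps q p j) [1..<p])"
  proof -
    have "even p \<Longrightarrow> odd q" using assms(1) by (metis coprime_common_divisor odd_one)
    then show ?thesis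
      by (auto simp: u_frac_def u_hat_def word_inv_def rev_map comp_def case_prod_beta minus_one_power_iff)
  qed
  also have "\<dots> ! i = eps q p i"
  proof -
    consider "i = 0" | "0 < i" "i < p" | "i = p" | "p < i" by linarith
    then show ?thesis
    proof cases
      case 4
      define j where "j = i - p"
      have j: "0 < j" "j < p" "i = p + j" using 4 assms by (auto simp: j_def)
      have "rev (map (\<lambda>j. - eps q p j) [1..<p]) ! (j - 1) = - eps q p (p - j)"
        using j nth_upt[of "Suc 0" "p - Suc j" p] by (simp add: rev_nth Suc_diff_Suc)
      then show ?thesis
        using j eps_reflect[OF assms(1), of j] by (auto simp: nth_append nth_Cons')
    qed (use assms in \<open>auto simp: eps_eq nth_append nth_Cons'\<close>)
  qed
  finally show ?thesis by (simp add: eps_eq)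
qed

lemma quotient_of_frac:
  assumes "coprime q p" "0 < p"
  shows "quotient_of (of_nat q / of_nat p) = (int q, int p)"
proof -
  have "of_nat q / of_nat p = Fract (int q) (int p)" by (simp add: Fract_of_int_quotient)
  then show ?thesis using assms by (simp add: quotient_of_Fract normalize_stable)
qed

text \<open>The letters \<open>i\<close> with \<open>\<lfloor>i q / p\<rfloor> = j\<close>, those from \<open>\<lceil>j p / q\<rceil>\<close> up to \<open>\<lceil>(j + 1) p / q\<rceil> - 1\<close>, form the
  block number \<open>j\<close>.\<close>

lemma CS_frac:
  assumes "coprime q p" "0 < q" "q \<le> p"
  shows "CS (of_nat q / of_nat p) = cyc (steps (\<lambda>j. ceil_div (j * p) q) (2 * q))"
proof -
  have p: "0 < p" using assms by simp
  have "CS_word (u_frac q p) = cyc (steps (\<lambda>j. ceil_div (j * p) q) (2 * q))"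
  proof (rule CS_word_boundaries)
    show "ceil_div (0 * p) q = 0" using assms by (simp add: ceil_div_def)
    show "strict_mono (\<lambda>j. ceil_div (j * p) q)"
      unfolding strict_mono_Suc_iff
    proof
      fix j
      \<comment> \<open>By \<open>q \<le> p\<close>, no block is empty.\<close>
      have "Suc (ceil_div (j * p) q) = ceil_div (1 * q + j * p) q"
        using assms by (subst ceil_div_add_mult) auto
      also have "\<dots> \<le> ceil_div (Suc j * p) q" using assms by (intro ceil_div_mono) simp
      finally show "ceil_div (j * p) q < ceil_div (Suc j * p) q" by simp
    qed
    have "ceil_div (2 * q * p) q = ceil_div (2 * p * q + 0) q" by (simp add: mult_ac)
    also have "\<dots> = 2 * p" using assms by (subst ceil_div_add_mult) (auto simp: ceil_div_def)
    finally show "length (u_frac q p) = ceil_div (2 * q * p) q" using length_u_frac[OF p] by simp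
  next
    fix i j assume j: "j < 2 * q" and i: "ceil_div (j * p) q \<le> i" "i < ceil_div (Suc j * p) q"
    have "j * p \<le> i * q" "\<not> Suc j * p \<le> i * q"
      unfolding ceil_div_le_iff[OF assms(2), symmetric] using i by simp_all
    then have "i * q < Suc j * p" by simp
    then have "i * q div p = j" using \<open>j * p \<le> i * q\<close> by (simp add: div_nat_eqI mult.commute)
    moreover have "i * q < 2 * p * q"
    proof -
      have "i * q < Suc j * p" by fact
      also have "\<dots> \<le> 2 * q * p" using j by (intro mult_le_mono1) simp
      finally show ?thesis by (simp only: mult_ac)
    qed
    then have "i < 2 * p" by simp
    ultimately show "sgn (snd (u_frac q p ! i)) = (-1) ^ j"
      using u_frac_sign[OF assms(1) p] by (simp add: minus_one_power_iff)
  qed (use assms in auto)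
  then show ?thesis using quotient_of_frac[OF assms(1) p] by (simp add: CS_def u_word_def)
qed


section \<open>The two recursions\<close>

text \<open>This is \<open>\<lceil>j p / q\<rceil> = j + \<lceil>j (p - q) / q\<rceil>\<close>.\<close>

lemma steps_ceil_shift:
  assumes "0 < q" "q \<le> p"
  shows "steps (\<lambda>j. ceil_div (j * p) q) n = map (\<lambda>a. a + 1) (steps (\<lambda>j. ceil_div (j * (p - q)) q) n)"
proof -
  have c: "ceil_div (j * p) q = j + ceil_div (j * (p - q)) q" for j
  proof -
    have "j * p = j * q + j * (p - q)" using assms by (simp flip: distrib_left)
    then show ?thesis using assms by (simp add: ceil_div_add_mult)
  qed
  have "ceil_div (j * (p - q)) q \<le> ceil_div (Suc j * (p - q)) q" for j
    by (intro ceil_div_mono) simp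
  then show ?thesis by (simp add: steps_def c Suc_diff_le comp_def)
qed

text \<open>The reflection \<open>j \<mapsto> 2 q - j\<close> of \<open>{0..2 q}\<close> exchanges floor and ceiling, because \<open>2 p\<close>, the value
  at its right end, is an integer.\<close>

lemma steps_ceil_floor:
  assumes "0 < q"
  shows "steps (\<lambda>j. ceil_div (j * p) q) (2 * q) = rev (steps (\<lambda>l. l * p div q) (2 * q))"
proof (rule steps_reflect[where N = "2 * p"])
  fix j assume j: "j \<le> 2 * q"
  have jp: "j * p \<le> 2 * p * q" using j mult_le_mono1[OF j, of p] by (simp add: mult_ac)
  then have le: "ceil_div (j * p) q \<le> 2 * p" using assms by (simp add: ceil_div_le_iff)
  have eq: "(2 * q - j) * p = 2 * p * q - j * p"
    unfolding diff_mult_distrib by (simp add: mult_ac)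
  \<comment> \<open>Both numbers have the same lower bounds \<open>m\<close>, so they agree.\<close>
  have "m \<le> (2 * q - j) * p div q \<longleftrightarrow> m \<le> 2 * p - ceil_div (j * p) q" for m
  proof (cases "m \<le> 2 * p")
    case True
    then have "m * q \<le> 2 * p * q" by simp
    have "m \<le> (2 * q - j) * p div q \<longleftrightarrow> m * q \<le> 2 * p * q - j * p"
      using assms by (simp add: less_eq_div_iff_mult_less_eq eq)
    also have "\<dots> \<longleftrightarrow> j * p \<le> (2 * p - m) * q"
      unfolding diff_mult_distrib using jp \<open>m * q \<le> 2 * p * q\<close> by linarith
    also have "\<dots> \<longleftrightarrow> ceil_div (j * p) q \<le> 2 * p - m" using assms by (simp add: ceil_div_le_iff)
    also have "\<dots> \<longleftrightarrow> m \<le> 2 * p - ceil_div (j * p) q" using True le by auto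
    finally show ?thesis .
  next
    case False
    have "(2 * q - j) * p div q \<le> 2 * p * q div q" unfolding eq by (intro div_le_mono) simp
    then show ?thesis using False assms by auto
  qed
  then have "(2 * q - j) * p div q = 2 * p - ceil_div (j * p) q"
    by (metis order_antisym order_refl)
  with le show "ceil_div (j * p) q \<le> 2 * p \<and> (2 * q - j) * p div q = 2 * p - ceil_div (j * p) q"
    by simp
qed

text \<open>Write \<open>p = q + s\<close>. As \<open>\<lceil>j p / q\<rceil> = j + \<lceil>j s / q\<rceil>\<close>, the steps on the left are 1 or 2, and a 2
  occurs exactly where \<open>\<lceil>j s / q\<rceil>\<close> jumps, which is at the positions \<open>j = \<lfloor>l q / s\<rfloor>\<close>. The distance of
  two successive jumps is one less than the corresponding step of \<open>\<lfloor>l p / s\<rfloor> = l + \<lfloor>l q / s\<rfloor>\<close>.\<close>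

lemma steps_ceil_segments:
  assumes "0 < s" "s \<le> q"
  shows "steps (\<lambda>j. ceil_div (j * (q + s)) q) (2 * q) =
    concat (map (\<lambda>a. [2] @ replicate (a - 2) 1) (steps (\<lambda>l. l * (q + s) div s) (2 * s)))"
proof -
  define e where "e = (\<lambda>j. ceil_div (j * s) q)"
  define g where "g = (\<lambda>l. l * q div s)"
  \<comment> \<open>The functions are adjoint, so \<open>e\<close> jumps from \<open>l\<close> to \<open>l + 1\<close> just after \<open>g l\<close>.\<close>
  have galois: "e j \<le> m \<longleftrightarrow> j \<le> g m" for j m
    using assms by (simp add: e_def g_def ceil_div_le_iff less_eq_div_iff_mult_less_eq mult.commute)
  have g_less: "g l < g (Suc l)" for l
  proof -
    have "Suc (l * q div s) = (l * q + s) div s" using assms by simp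
    also have "\<dots> \<le> Suc l * q div s" using assms by (intro div_le_mono) simp
    finally show ?thesis by (simp add: g_def)
  qed
  then have "mono g" by (simp add: mono_iff_le_Suc less_imp_le)
  have ends: "g 0 = 0" "g (2 * s) = 2 * q" using assms by (auto simp: g_def)
  have c: "ceil_div (j * (q + s)) q = j + e j" for j
    using assms by (simp add: distrib_left ceil_div_add_mult e_def)
  have h: "l * (q + s) div s = l + g l" for l
    using assms by (simp add: distrib_left g_def)
  define d where "d = (\<lambda>j. (Suc j + e (Suc j)) - (j + e j))"
  \<comment> \<open>Up to the next jump, the only step of length 2 is the first one.\<close>
  have seg: "map d [g l..<g (Suc l)] = [2] @ replicate (g (Suc l) - g l - 1) 1" for l
  proof -
    have step: "e j = Suc l" if "g l < j" "j \<le> g (Suc l)" for j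
      using that galois[of j l] galois[of j "Suc l"] by simp
    have "e (g l) = l"
    proof (cases l)
      case 0
      then show ?thesis using galois[of "g 0" 0] by simp
    next
      case (Suc k)
      then show ?thesis using galois[of "g l" k] galois[of "g l" l] g_less[of k] by simp
    qed
    then have "d (g l) = 2" using step[of "Suc (g l)"] g_less[of l] by (simp add: d_def)
    moreover have "map d [Suc (g l)..<g (Suc l)] = replicate (g (Suc l) - g l - 1) 1"
      by (rule nth_equalityI) (auto simp: d_def step)
    ultimately show ?thesis using g_less[of l] by (simp add: upt_conv_Cons)
  qed
  have "steps (\<lambda>j. ceil_div (j * (q + s)) q) (2 * q) = map d [g 0..<g (2 * s)]"
    unfolding c ends by (simp add: steps_def d_def)
  also have "\<dots> = concat (map (\<lambda>l. map d [g l..<g (Suc l)]) [0..<2 * s])"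
    unfolding concat_upt_partition[OF \<open>mono g\<close>, symmetric] by (simp add: map_concat comp_def)
  also have "\<dots> = concat (map (\<lambda>a. [2] @ replicate (a - 2) 1) (steps (\<lambda>l. l + g l) (2 * s)))"
    unfolding seg steps_def map_map comp_def
    by (intro arg_cong[where f = concat] map_cong refl) simp
  finally show ?thesis unfolding h .
qed

lemma steps_ceil_ge2:
  assumes "0 < s" "2 * s \<le> p" "a \<in> set (steps (\<lambda>j. ceil_div (j * p) s) n)"
  shows "a \<ge> 2"
proof -
  obtain j where a: "a = ceil_div (Suc j * p) s - ceil_div (j * p) s"
    using assms(3) by (auto simp: steps_def)
  have "2 + ceil_div (j * p) s = ceil_div (2 * s + j * p) s"
    using assms by (subst ceil_div_add_mult) auto
  also have "\<dots> \<le> ceil_div (Suc j * p) s" using assms by (intro ceil_div_mono) simp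
  finally show ?thesis using a by simp
qed

lemma cfrac_bounds:
  assumes "\<forall>m\<in>set ms. m \<ge> 1" shows "0 \<le> cfrac ms" "cfrac ms \<le> 1"
proof -
  have "0 \<le> cfrac ms \<and> cfrac ms \<le> 1" using assms
  proof (induction ms)
    case (Cons m ms)
    have "(1 :: rat) \<le> of_nat m" using Cons.prems by simp
    then have "1 \<le> of_nat m + cfrac ms" using Cons by simp
    then show ?case by simp
  qed simp
  then show "0 \<le> cfrac ms" "cfrac ms \<le> 1" by auto
qed

text \<open>Lowering the first entry by 1 lowers the reciprocal \<open>y\<close> of the fraction by 1.\<close>

lemma cfrac_tilde_ge2:
  assumes "\<forall>m\<in>set (m # ms). m \<ge> 1" "m \<ge> 2"
  shows "cfrac (m # ms) \<le> 1 / 2"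
    and "cfrac (tilde (m # ms)) = cfrac (m # ms) / (1 - cfrac (m # ms))"
proof -
  define y where "y = of_nat m + cfrac ms"
  have "(2 :: rat) \<le> of_nat m" using assms(2) by (metis of_nat_le_iff of_nat_numeral)
  then have y: "2 \<le> y" using cfrac_bounds(1)[of ms] assms(1) by (simp add: y_def)
  then show "cfrac (m # ms) \<le> 1 / 2"
    unfolding cfrac.simps y_def[symmetric] by (simp add: field_simps)
  have "cfrac (tilde (m # ms)) = 1 / (y - 1)" using assms(2) by (simp add: y_def of_nat_diff algebra_simps)
  also have "\<dots> = (1 / y) / (1 - 1 / y)" using y by (simp add: field_simps)
  finally show "cfrac (tilde (m # ms)) = cfrac (m # ms) / (1 - cfrac (m # ms))" by (simp add: y_def)
qed

text \<open>If \<open>y\<close> is the reciprocal of \<open>cfrac ms\<close>, then the two fractions are \<open>y / (y + 1)\<close> and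
  \<open>1 / (y + 1)\<close>.\<close>

lemma cfrac_tilde_1:
  assumes "\<forall>m\<in>set ms. m \<ge> 1" "ms \<noteq> []"
  shows "1 / 2 \<le> cfrac (1 # ms)" and "cfrac (tilde (1 # ms)) = 1 - cfrac (1 # ms)"
proof -
  have "0 \<le> cfrac ms" "cfrac ms \<le> 1" using cfrac_bounds[OF assms(1)] by auto
  then show "1 / 2 \<le> cfrac (1 # ms)" by (simp add: field_simps)
  obtain m ms' where ms: "ms = m # ms'" using assms(2) by (cases ms) auto
  define y where "y = of_nat m + cfrac ms'"
  have "(1 :: rat) \<le> of_nat m" using assms(1) ms by simp
  then have y: "1 \<le> y" using cfrac_bounds(1)[of ms'] assms(1) ms by (simp add: y_def)
  have "cfrac (tilde (1 # ms)) = 1 / (1 + y)" by (simp add: ms y_def algebra_simps)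
  also have "\<dots> = 1 - 1 / (1 + 1 / y)" using y by (simp add: field_simps)
  finally show "cfrac (tilde (1 # ms)) = 1 - cfrac (1 # ms)" by (simp add: ms y_def)
qed

lemma CS_shift:
  assumes "coprime q p" "0 < q" "2 * q \<le> p" and bs: "CS (of_nat q / of_nat (p - q)) = cyc bs"
  shows "CS (of_nat q / of_nat p) = cyc (map (\<lambda>a. a + 1) bs)"
proof -
  let ?c = "\<lambda>p j. ceil_div (j * p) q"
  have "coprime q (q + (p - q))" using assms by simp
  then have "coprime q (p - q)" by (simp only: coprime_iff_gcd_eq_1 gcd_add2)
  then have "cyc bs = cyc (steps (?c (p - q)) (2 * q))" using CS_frac[of q "p - q"] assms by simp
  then have "map (\<lambda>a. a + 1) bs \<in> cyc (map (\<lambda>a. a + 1) (steps (?c (p - q)) (2 * q)))"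
    by (intro cyc_map) (simp only: cyc_eq_iff)
  also have "map (\<lambda>a. a + 1) (steps (?c (p - q)) (2 * q)) = steps (?c p) (2 * q)"
    using assms by (subst steps_ceil_shift[of q p]) auto
  finally show ?thesis using CS_frac[of q p] assms by (simp add: cyc_eq_iff cyc_sym)
qed

lemma CS_complement:
  assumes "coprime q p" "q < p" "p \<le> 2 * q" and bs: "CS (of_nat (p - q) / of_nat p) = cyc bs"
  shows "\<forall>a\<in>set bs. a \<ge> 2"
    and "CS (of_nat q / of_nat p) = cyc (concat (map (\<lambda>a. [2] @ replicate (a - 2) 1) (rev bs)))"
proof -
  define s where "s = p - q"
  let ?seg = "\<lambda>a. [2 :: nat] @ replicate (a - 2) 1"
  have s: "0 < s" "s \<le> q" "p = q + s" using assms by (auto simp: s_def)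
  have "coprime q s" using assms(1) s(3) by (simp only: coprime_iff_gcd_eq_1 gcd_add2)
  then have "coprime s p"
    unfolding s(3) coprime_iff_gcd_eq_1 by (metis add.commute gcd_add2 gcd.commute)
  moreover have "s \<le> p" using s(3) by simp
  ultimately have "cyc bs = cyc (steps (\<lambda>j. ceil_div (j * p) s) (2 * s))"
    using CS_frac[of s p] s(1) bs[folded s_def] by simp
  then have mem: "bs \<in> cyc (steps (\<lambda>j. ceil_div (j * p) s) (2 * s))" by (simp only: cyc_eq_iff)
  show "\<forall>a\<in>set bs. a \<ge> 2"
    using steps_ceil_ge2[of s p] s set_cyc[OF mem] by auto
  have "rev bs \<in> cyc (steps (\<lambda>l. l * p div s) (2 * s))"
    using cyc_rev[OF mem] s(1) by (simp add: steps_ceil_floor)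
  then have "concat (map ?seg (rev bs)) \<in> cyc (concat (map ?seg (steps (\<lambda>l. l * p div s) (2 * s))))"
    by (intro cyc_concat cyc_map)
  also have "concat (map ?seg (steps (\<lambda>l. l * p div s) (2 * s))) = steps (\<lambda>j. ceil_div (j * p) q) (2 * q)"
    unfolding s(3) using steps_ceil_segments[OF s(1,2)] by simp
  finally have "concat (map ?seg (rev bs)) \<in> cyc (steps (\<lambda>j. ceil_div (j * p) q) (2 * q))" .
  then show "CS (of_nat q / of_nat p) = cyc (concat (map ?seg (rev bs)))"
    using CS_frac[of q p] assms(1,2) s(1,2) by (metis cyc_eq_iff gr_zeroI le_zero_eq less_imp_le)
qed

theorem proposition4p2:
  fixes ms as :: "nat list" and r rt :: rat
  assumes "cfrac_expansion ms r" and "0 < r" and "r < 1"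
    and "rt = cfrac (tilde ms)"
    and "CS rt = cyc (as @ as)"
  shows
    "(hd ms \<ge> 2 \<longrightarrow> CS r = cyc (map (\<lambda>a. a + 1) as @ map (\<lambda>a. a + 1) as)) \<and>
     (hd ms = 1 \<longrightarrow>
        (\<forall>a\<in>set as. a \<ge> 2) \<and>
        (let seg = (\<lambda>a. [2] @ replicate (a - 2) 1) in
           CS r = cyc (concat (map seg as) @ concat (map seg as)) \<or>
           CS r = cyc (concat (map seg (rev as)) @ concat (map seg (rev as)))))"
proof -
  obtain a b where ab: "quotient_of r = (a, b)" by (cases "quotient_of r")
  define q p where "q = nat a" and "p = nat b"
  have b: "b > 0" and cop: "coprime a b" and r_ab: "r = of_int a / of_int b"
    using quotient_of_denom_pos[OF ab] quotient_of_coprime[OF ab] quotient_of_div[OF ab] by auto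
  have "a > 0" using r_ab b \<open>0 < r\<close> by (simp add: zero_less_divide_iff)
  then have int: "a = int q" "b = int p" using b by (auto simp: q_def p_def)
  have qp: "coprime q p" "0 < q" "0 < p" "r = of_nat q / of_nat p"
    using cop int r_ab \<open>a > 0\<close> b by auto
  have "q < p" using \<open>r < 1\<close> qp by simp
  obtain m ms' where ms: "ms = m # ms'" and pos: "\<forall>m\<in>set ms. m \<ge> 1" and r: "r = cfrac ms"
    using assms(1) by (cases ms) (auto simp: cfrac_expansion_def)
  have part1: "CS r = cyc (map (\<lambda>a. a + 1) as @ map (\<lambda>a. a + 1) as)" if "hd ms \<ge> 2"
  proof -
    have "r \<le> 1 / 2" "rt = r / (1 - r)"
      using cfrac_tilde_ge2[of m ms'] pos ms r that assms(4) by auto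
    have "of_nat (2 * q) \<le> (of_nat p :: rat)" using \<open>r \<le> 1 / 2\<close> qp by (simp add: field_simps)
    then have "2 * q \<le> p" by (simp only: of_nat_le_iff)
    have "rt = of_nat q / of_nat (p - q)"
      using \<open>rt = r / (1 - r)\<close> qp \<open>q < p\<close> by (simp add: of_nat_diff field_simps)
    then show ?thesis
      using CS_shift[OF qp(1,2) \<open>2 * q \<le> p\<close>, of "as @ as"] assms(5) qp(4) by simp
  qed
  \<comment> \<open>The second alternative of the disjunction holds in every case.\<close>
  have part2: "(\<forall>a\<in>set as. a \<ge> 2) \<and>
      CS r = cyc (concat (map (\<lambda>a. [2] @ replicate (a - 2) 1) (rev as)) @
                  concat (map (\<lambda>a. [2] @ replicate (a - 2) 1) (rev as)))" if "hd ms = 1"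
  proof -
    have "ms' \<noteq> []" using \<open>r < 1\<close> r ms that by auto
    then have "1 / 2 \<le> r" "rt = 1 - r"
      using cfrac_tilde_1[of ms'] pos ms r that assms(4) by auto
    have "of_nat p \<le> (of_nat (2 * q) :: rat)" using \<open>1 / 2 \<le> r\<close> qp by (simp add: field_simps)
    then have "p \<le> 2 * q" by (simp only: of_nat_le_iff)
    have "rt = of_nat (p - q) / of_nat p"
      using \<open>rt = 1 - r\<close> qp \<open>q < p\<close> by (simp add: of_nat_diff field_simps)
    then show ?thesis
      using CS_complement[OF qp(1) \<open>q < p\<close> \<open>p \<le> 2 * q\<close>, of "as @ as"] assms(5) qp(4) by simp
  qed
  show ?thesis using part1 part2 by (simp add: Let_def)
qed

end
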